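(* Let $Q$ be a loop that is universally flexible and has the inverse property. Then $Q$ is a Moufang loop.
   Context: A loop $(Q,\cdot,\backslash,/,1)$ is a set $Q$ with binary operations $\cdot,\backslash,/$ and an element $1$ such that $x\backslash(x\cdot y)=y=(y\cdot x)/x$, $x\cdot(x\backslash y)=y=(y/x)\cdot x$ and $1\cdot x=x=x\cdot 1$ for all $x,y\in Q$; equivalently, $1$ is a two-sided identity and all left and right multiplication maps are bijections. For $a,b\in Q$, the (principal) loop isotope of $Q$ determined by $a,b$ is the loop on the set $Q$ with multiplication $x\cdot_{a,b}y=(x/a)\cdot(b\backslash y)$ (its identity element is $b\cdot a$). A loop is flexible if $x\cdot(y\cdot x)=(x\cdot y)\cdot x$ for all $x,y$. A loop $Q$ is universally flexible if every loop isotope $(Q,\cdot_{a,b})$, $a,b\in Q$, is flexible. A loop has the inverse property (IP) if $1/x=x\backslash 1$ for all $x$ (the common value being denoted $x^{-1}$) and $x^{-1}\cdot(x\cdot y)=y=(y\cdot x)\cdot x^{-1}$ for all $x,y$. A loop is Moufang if it satisfies any (equivalently, all) of the following four equivalent identities: $(x\cdot(y\cdot z))\cdot x=(x\cdot y)\cdot(z\cdot x)$; $x\cdot((y\cdot z)\cdot x)=(x\cdot y)\cdot(z\cdot x)$; $((x\cdot y)\cdot z)\cdot y=x\cdot(y\cdot(z\cdot y))$; $x\cdot(y\cdot(x\cdot z))=((x\cdot y)\cdot x)\cdot z$. *)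

theory Defs
  imports "HOL-Algebra.Group"
begin

record 'a loop = "'a monoid" +
  ldiv :: "['a, 'a] \<Rightarrow> 'a"  (infixl "\<setminus>\<index>" 70)
  rdiv :: "['a, 'a] \<Rightarrow> 'a"  (infixl "\<oslash>\<index>" 70)

text \<open>The record extends \<^typ>\<open>'a monoid\<close> only to share the multiplication and unit syntax;
  associativity is not assumed. \<open>x \<setminus> y\<close> is the solution \<open>z\<close> of \<open>x \<otimes> z = y\<close>, and
  \<open>y \<oslash> x\<close> is the solution \<open>z\<close> of \<open>z \<otimes> x = y\<close>.\<close>

locale loop =
  fixes Q (structure)
  assumes mult_closed [intro, simp]:
      "\<lbrakk>x \<in> carrier Q; y \<in> carrier Q\<rbrakk> \<Longrightarrow> x \<otimes> y \<in> carrier Q"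
    and ldiv_closed [intro, simp]:
      "\<lbrakk>x \<in> carrier Q; y \<in> carrier Q\<rbrakk> \<Longrightarrow> x \<setminus> y \<in> carrier Q"
    and rdiv_closed [intro, simp]:
      "\<lbrakk>x \<in> carrier Q; y \<in> carrier Q\<rbrakk> \<Longrightarrow> x \<oslash> y \<in> carrier Q"
    and one_closed [intro, simp]: "\<one> \<in> carrier Q"
    and ldiv_mult [simp]:
      "\<lbrakk>x \<in> carrier Q; y \<in> carrier Q\<rbrakk> \<Longrightarrow> x \<setminus> (x \<otimes> y) = y"
    and mult_rdiv [simp]:
      "\<lbrakk>x \<in> carrier Q; y \<in> carrier Q\<rbrakk> \<Longrightarrow> (y \<otimes> x) \<oslash> x = y"
    and mult_ldiv [simp]:
      "\<lbrakk>x \<in> carrier Q; y \<in> carrier Q\<rbrakk> \<Longrightarrow> x \<otimes> (x \<setminus> y) = y"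
    and rdiv_mult [simp]:
      "\<lbrakk>x \<in> carrier Q; y \<in> carrier Q\<rbrakk> \<Longrightarrow> (y \<oslash> x) \<otimes> x = y"
    and l_one [simp]: "x \<in> carrier Q \<Longrightarrow> \<one> \<otimes> x = x"
    and r_one [simp]: "x \<in> carrier Q \<Longrightarrow> x \<otimes> \<one> = x"

text \<open>The two divisions of an isotope are forced by its multiplication.\<close>

definition loop_isotope :: "('a, 'm) loop_scheme \<Rightarrow> 'a \<Rightarrow> 'a \<Rightarrow> ('a, 'm) loop_scheme" where
  "loop_isotope Q a b = Q
    \<lparr> mult := (\<lambda>x y. (x \<oslash>\<^bsub>Q\<^esub> a) \<otimes>\<^bsub>Q\<^esub> (b \<setminus>\<^bsub>Q\<^esub> y)),
      one := b \<otimes>\<^bsub>Q\<^esub> a,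
      ldiv := (\<lambda>x y. b \<otimes>\<^bsub>Q\<^esub> ((x \<oslash>\<^bsub>Q\<^esub> a) \<setminus>\<^bsub>Q\<^esub> y)),
      rdiv := (\<lambda>x y. (x \<oslash>\<^bsub>Q\<^esub> (b \<setminus>\<^bsub>Q\<^esub> y)) \<otimes>\<^bsub>Q\<^esub> a) \<rparr>"

lemma (in loop) loop_isotope_loop:
  assumes "a \<in> carrier Q" "b \<in> carrier Q"
  shows "loop (loop_isotope Q a b)"
  using assms by unfold_locales (simp_all add: loop_isotope_def)

definition flexible :: "('a, 'm) loop_scheme \<Rightarrow> bool" where
  "flexible Q \<longleftrightarrow> (\<forall>x\<in>carrier Q. \<forall>y\<in>carrier Q.
     x \<otimes>\<^bsub>Q\<^esub> (y \<otimes>\<^bsub>Q\<^esub> x) = (x \<otimes>\<^bsub>Q\<^esub> y) \<otimes>\<^bsub>Q\<^esub> x)"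

definition universally_flexible :: "('a, 'm) loop_scheme \<Rightarrow> bool" where
  "universally_flexible Q \<longleftrightarrow>
     (\<forall>a\<in>carrier Q. \<forall>b\<in>carrier Q. flexible (loop_isotope Q a b))"

definition inverse_property :: "('a, 'm) loop_scheme \<Rightarrow> bool" where
  "inverse_property Q \<longleftrightarrow>
     (\<forall>x\<in>carrier Q. \<one>\<^bsub>Q\<^esub> \<oslash>\<^bsub>Q\<^esub> x = x \<setminus>\<^bsub>Q\<^esub> \<one>\<^bsub>Q\<^esub>) \<and>
     (\<forall>x\<in>carrier Q. \<forall>y\<in>carrier Q.
        (x \<setminus>\<^bsub>Q\<^esub> \<one>\<^bsub>Q\<^esub>) \<otimes>\<^bsub>Q\<^esub> (x \<otimes>\<^bsub>Q\<^esub> y) = y \<and>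
        (y \<otimes>\<^bsub>Q\<^esub> x) \<otimes>\<^bsub>Q\<^esub> (x \<setminus>\<^bsub>Q\<^esub> \<one>\<^bsub>Q\<^esub>) = y)"

text \<open>In a loop the four Moufang identities are equivalent; all of them are required here, so
  that nothing depends on the choice of one.\<close>

locale moufang_loop = loop +
  assumes moufang1: "\<lbrakk>x \<in> carrier Q; y \<in> carrier Q; z \<in> carrier Q\<rbrakk> \<Longrightarrow>
      (x \<otimes> (y \<otimes> z)) \<otimes> x = (x \<otimes> y) \<otimes> (z \<otimes> x)"
    and moufang2: "\<lbrakk>x \<in> carrier Q; y \<in> carrier Q; z \<in> carrier Q\<rbrakk> \<Longrightarrow>
      x \<otimes> ((y \<otimes> z) \<otimes> x) = (x \<otimes> y) \<otimes> (z \<otimes> x)"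
    and moufang3: "\<lbrakk>x \<in> carrier Q; y \<in> carrier Q; z \<in> carrier Q\<rbrakk> \<Longrightarrow>
      ((x \<otimes> y) \<otimes> z) \<otimes> y = x \<otimes> (y \<otimes> (z \<otimes> y))"
    and moufang4: "\<lbrakk>x \<in> carrier Q; y \<in> carrier Q; z \<in> carrier Q\<rbrakk> \<Longrightarrow>
      x \<otimes> (y \<otimes> (x \<otimes> z)) = ((x \<otimes> y) \<otimes> x) \<otimes> z"

end

theory Submission
  imports Defs
begin

text \<open>
  Under the inverse property the two divisions are multiplications by inverses, so flexibility
  of all isotopes becomes one identity in the multiplication of \<open>Q\<close>:
  \<open>(x a) \<cdot> (b \<cdot> ((y a) \<cdot> (b x))) = (((x a) \<cdot> (b y)) \<cdot> a) \<cdot> (b x)\<close> for all \<open>x, y, a, b\<close>.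
  As a statement about translations applied to \<open>y\<close>, it says that the composite
  \<open>L\<^bsub>xa\<^esub> L\<^bsub>b\<^esub>\<close> of left translations commutes with the composite
  \<open>R\<^bsub>bx\<^esub> R\<^bsub>a\<^esub>\<close> of right translations.

  Two special cases suffice. If \<open>b x = 1\<close>, one translation disappears, and what remains says
  that \<open>(u \<cdot> (v \<cdot> z)) \<cdot> w = u \<cdot> (v \<cdot> (z \<cdot> w))\<close> whenever \<open>u\<close> is the inverse of \<open>w v\<close>
  (lemma \<open>reassociate_inverse_product\<close>). If \<open>y\<close> is the inverse of \<open>b\<close>, the factor \<open>b y\<close>
  disappears on the right-hand side, while the left-hand side contains a product of exactly
  the shape that the first case re-associates. Together they give the left Bol identity
  (lemma \<open>left_Bol\<close>).

  In an inverse property loop inversion is an antiautomorphism, so the left Bol identity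
  implies the right one. Flexibility of \<open>Q\<close> itself, the isotope with \<open>a = b = 1\<close>, turns the
  two Bol identities into the fourth and the third Moufang identity. Moving one factor of the
  left Bol identity to the other side of the equation gives the second Moufang identity, and
  by flexibility the first.
\<close>

locale ip_loop = loop +
  assumes ip: "inverse_property Q"
begin

abbreviation inverse_elem :: "'a \<Rightarrow> 'a"  ("_\<^sup>-" [81] 80)
  where "x\<^sup>- \<equiv> x \<setminus> \<one>"

lemma inv_mult_cancel [simp]: "\<lbrakk>x \<in> carrier Q; y \<in> carrier Q\<rbrakk> \<Longrightarrow> x\<^sup>- \<otimes> (x \<otimes> y) = y"
  and mult_inv_cancel [simp]: "\<lbrakk>x \<in> carrier Q; y \<in> carrier Q\<rbrakk> \<Longrightarrow> (y \<otimes> x) \<otimes> x\<^sup>- = y"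
  using ip by (auto simp: inverse_property_def)

lemma inv_inv [simp]: "x \<in> carrier Q \<Longrightarrow> (x\<^sup>-)\<^sup>- = x"
  by (metis inv_mult_cancel ldiv_closed mult_ldiv one_closed r_one)

lemma mult_inv_mult_cancel [simp]:
    "\<lbrakk>x \<in> carrier Q; y \<in> carrier Q\<rbrakk> \<Longrightarrow> x \<otimes> (x\<^sup>- \<otimes> y) = y"
  and mult_inv_mult_cancel' [simp]:
    "\<lbrakk>x \<in> carrier Q; y \<in> carrier Q\<rbrakk> \<Longrightarrow> (y \<otimes> x\<^sup>-) \<otimes> x = y"
  by (metis inv_inv inv_mult_cancel ldiv_closed one_closed,
      metis inv_inv mult_inv_cancel ldiv_closed one_closed)

lemma ldiv_eq_mult_inv: "\<lbrakk>x \<in> carrier Q; y \<in> carrier Q\<rbrakk> \<Longrightarrow> x \<setminus> y = x\<^sup>- \<otimes> y"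
  by (metis inv_mult_cancel ldiv_closed mult_ldiv)

lemma rdiv_eq_mult_inv: "\<lbrakk>x \<in> carrier Q; y \<in> carrier Q\<rbrakk> \<Longrightarrow> y \<oslash> x = y \<otimes> x\<^sup>-"
  by (metis mult_inv_cancel rdiv_closed rdiv_mult)

lemma inv_mult:
  assumes "x \<in> carrier Q" "y \<in> carrier Q"
  shows "(x \<otimes> y)\<^sup>- = y\<^sup>- \<otimes> x\<^sup>-"
proof -
  have "(x \<otimes> y)\<^sup>- \<otimes> x = (x \<otimes> y)\<^sup>- \<otimes> ((x \<otimes> y) \<otimes> y\<^sup>-)"
    using assms by simp
  also have "\<dots> = y\<^sup>-"
    using assms by (simp del: mult_inv_cancel)
  finally show ?thesis
    using assms by (metis ldiv_closed mult_closed mult_inv_cancel one_closed)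
qed

end

locale universally_flexible_ip_loop = ip_loop +
  assumes uf: "universally_flexible Q"
begin

text \<open>This is flexibility of the isotope determined by \<open>a\<^sup>-\<close> and \<open>b\<^sup>-\<close>; taking inverses makes
  the divisions of the isotope plain multiplications by \<open>a\<close> and \<open>b\<close>.\<close>

lemma isotope_flexible:
  assumes "x \<in> carrier Q" "y \<in> carrier Q" "a \<in> carrier Q" "b \<in> carrier Q"
  shows "(x \<otimes> a) \<otimes> (b \<otimes> ((y \<otimes> a) \<otimes> (b \<otimes> x))) = (((x \<otimes> a) \<otimes> (b \<otimes> y)) \<otimes> a) \<otimes> (b \<otimes> x)"
proof -
  have "flexible (loop_isotope Q (a\<^sup>-) (b\<^sup>-))"
    using uf assms by (simp add: universally_flexible_def)
  then have "(x \<oslash> a\<^sup>-) \<otimes> (b\<^sup>- \<setminus> ((y \<oslash> a\<^sup>-) \<otimes> (b\<^sup>- \<setminus> x)))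
      = (((x \<oslash> a\<^sup>-) \<otimes> (b\<^sup>- \<setminus> y)) \<oslash> a\<^sup>-) \<otimes> (b\<^sup>- \<setminus> x)"
    using assms by (simp add: flexible_def loop_isotope_def)
  then show ?thesis
    using assms by (simp add: rdiv_eq_mult_inv ldiv_eq_mult_inv[of "b\<^sup>-"])
qed

lemma flexible_law:
  assumes "x \<in> carrier Q" "y \<in> carrier Q"
  shows "x \<otimes> (y \<otimes> x) = (x \<otimes> y) \<otimes> x"
  using isotope_flexible[of x y \<one> \<one>] assms by simp

text \<open>In \<open>isotope_flexible\<close>, take \<open>b = v\<close>, \<open>x = v\<^sup>-\<close> and \<open>a = w\<^sup>-\<close>. Then \<open>b x = \<one>\<close>
  and \<open>x a = (w v)\<^sup>-\<close>, so that \<open>L\<^bsub>xa\<^esub> L\<^bsub>v\<^esub>\<close> commutes with right translation by \<open>w\<^sup>-\<close>,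
  and therefore also with its inverse, right translation by \<open>w\<close>.\<close>

lemma reassociate_inverse_product:
  assumes "v \<in> carrier Q" "w \<in> carrier Q" "z \<in> carrier Q"
  shows "((w \<otimes> v)\<^sup>- \<otimes> (v \<otimes> z)) \<otimes> w = (w \<otimes> v)\<^sup>- \<otimes> (v \<otimes> (z \<otimes> w))"
proof -
  have "(w \<otimes> v)\<^sup>- \<otimes> (v \<otimes> z) = ((w \<otimes> v)\<^sup>- \<otimes> (v \<otimes> (z \<otimes> w))) \<otimes> w\<^sup>-"
    using isotope_flexible[of "v\<^sup>-" "z \<otimes> w" "w\<^sup>-" v] assms by (simp add: inv_mult)
  then show ?thesis
    using assms by simp
qed

text \<open>At \<open>y = b\<^sup>-\<close>, the right-hand side of \<open>isotope_flexible\<close> is \<open>(p \<cdot> a) \<cdot> w\<close> with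
  \<open>p = x a\<close> and \<open>w = b x\<close>. The choice \<open>x = q\<^sup>-\<close> forces \<open>a = q p\<close> and \<open>b = w q\<close>. On the
  left-hand side, \<open>(b\<^sup>- \<cdot> (q \<cdot> p)) \<cdot> w\<close> may then be re-associated, and \<open>b\<close> cancels.\<close>

lemma left_Bol:
  assumes p: "p \<in> carrier Q" and q: "q \<in> carrier Q" and w: "w \<in> carrier Q"
  shows "(p \<otimes> (q \<otimes> p)) \<otimes> w = p \<otimes> (q \<otimes> (p \<otimes> w))"
proof -
  define b where "b = w \<otimes> q"
  have b: "b \<in> carrier Q"
    using q w by (simp add: b_def)
  have "(p \<otimes> (q \<otimes> p)) \<otimes> w = p \<otimes> (b \<otimes> ((b\<^sup>- \<otimes> (q \<otimes> p)) \<otimes> w))"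
    using isotope_flexible[of "q\<^sup>-" "b\<^sup>-" "q \<otimes> p" b] p q w b by (simp add: b_def)
  also have "(b\<^sup>- \<otimes> (q \<otimes> p)) \<otimes> w = b\<^sup>- \<otimes> (q \<otimes> (p \<otimes> w))"
    using reassociate_inverse_product[of q w p] p q w by (simp add: b_def)
  also have "b \<otimes> (b\<^sup>- \<otimes> (q \<otimes> (p \<otimes> w))) = q \<otimes> (p \<otimes> w)"
    using p q w b by simp
  finally show ?thesis .
qed

text \<open>Inversion reverses products, so it carries the left Bol identity to the right one.\<close>

lemma right_Bol:
  assumes "p \<in> carrier Q" "q \<in> carrier Q" "w \<in> carrier Q"
  shows "((w \<otimes> p) \<otimes> q) \<otimes> p = w \<otimes> ((p \<otimes> q) \<otimes> p)"
  using arg_cong[OF left_Bol[of "p\<^sup>-" "q\<^sup>-" "w\<^sup>-"], of "\<lambda>u. u\<^sup>-"] assms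
  by (simp add: inv_mult)

text \<open>The left Bol identity says that \<open>(x \<cdot> u x) \<cdot> (x\<^sup>- v) = x \<cdot> u v\<close>. For \<open>u = y z\<close> and
  \<open>v = z\<^sup>-\<close> the product \<open>u v\<close> collapses to \<open>y\<close>, and \<open>x\<^sup>- v\<close> is the inverse of \<open>z x\<close>.\<close>

lemma middle_Moufang:
  assumes "x \<in> carrier Q" "y \<in> carrier Q" "z \<in> carrier Q"
  shows "x \<otimes> ((y \<otimes> z) \<otimes> x) = (x \<otimes> y) \<otimes> (z \<otimes> x)"
proof -
  have "(x \<otimes> ((y \<otimes> z) \<otimes> x)) \<otimes> (z \<otimes> x)\<^sup>- = x \<otimes> y"
    using assms by (simp add: inv_mult left_Bol)
  then show ?thesis
    using assms by (metis mult_closed mult_inv_mult_cancel')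
qed

lemma moufang: "moufang_loop Q"
proof
  fix x y z
  assume [simp]: "x \<in> carrier Q" "y \<in> carrier Q" "z \<in> carrier Q"
  show "x \<otimes> ((y \<otimes> z) \<otimes> x) = (x \<otimes> y) \<otimes> (z \<otimes> x)"
    by (simp add: middle_Moufang)
  then show "(x \<otimes> (y \<otimes> z)) \<otimes> x = (x \<otimes> y) \<otimes> (z \<otimes> x)"
    by (simp add: flexible_law)
  show "((x \<otimes> y) \<otimes> z) \<otimes> y = x \<otimes> (y \<otimes> (z \<otimes> y))"
    by (simp add: right_Bol flexible_law)
  show "x \<otimes> (y \<otimes> (x \<otimes> z)) = ((x \<otimes> y) \<otimes> x) \<otimes> z"
    using left_Bol[of x y z] flexible_law[of x y] by simp
qed

end

theorem theorem2p2:
  fixes Q :: "('a, 'm) loop_scheme"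
  assumes "loop Q"
    and "universally_flexible Q"
    and "inverse_property Q"
  shows "moufang_loop Q"
proof -
  interpret universally_flexible_ip_loop Q
    using assms
    by (simp add: universally_flexible_ip_loop_def universally_flexible_ip_loop_axioms_def
        ip_loop_def ip_loop_axioms_def)
  show ?thesis
    by (rule moufang)
qed

end
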